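(* Let $\alpha \in \mathbb{R}^{m\times n}$ have rows $\alpha_1,\dots,\alpha_m \in \mathbb{R}^{1\times n}$, let $i \in \{1,\dots,m\}$, and let $X \subset \mathbb{R}^n$ be a convex set with support function $\sigma_X(\lambda) = \sup_{x\in X} \lambda^{\intercal} x$. Then $\mathsf{C}_{\mathsf{AGE}}(\alpha,i,X)$ equals the set of all $c \in \mathbb{R}^m$ for which there exist $\nu \in \mathbb{R}^{m-1}$ and $\lambda \in \mathbb{R}^n$ satisfying $$\sigma_X(\lambda) + D(\nu, c_{\setminus i}) - \nu^{\intercal}\mathbf{1} \le c_i, \qquad [\alpha_{\setminus i} - \mathbf{1}\alpha_i]^{\intercal}\nu + \lambda = \mathbf{0}, \qquad c_{\setminus i} \ge \mathbf{0}.$$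
   Context: Inequalities between vectors are elementwise, and $\mathbf{1}$ is the vector of all ones. For a vector $c\in\mathbb{R}^m$, $c_{\setminus i}\in\mathbb{R}^{m-1}$ is $c$ with its $i$-th entry deleted; for a matrix $\alpha$, $\alpha_{\setminus i}$ is $\alpha$ with its $i$-th row deleted. Thus $\alpha_{\setminus i} - \mathbf{1}\alpha_i$ is the $(m-1)\times n$ matrix with rows $\alpha_j-\alpha_i$, $j\ne i$. For $\alpha\in\mathbb{R}^{m\times n}$ and $c\in\mathbb{R}^m$, $\mathrm{Sig}(\alpha,c)$ denotes the signomial $x\mapsto \sum_{j=1}^m c_j\exp(\alpha_j\cdot x)$ on $\mathbb{R}^n$. For $X\subset\mathbb{R}^n$ and an index $k \in \{1,\dots,m\}$, the $k$-th (conditional) AGE cone with respect to $\alpha, X$ is $$\mathsf{C}_{\mathsf{AGE}}(\alpha,k,X) = \{c\in\mathbb{R}^m : c_{\setminus k}\ge \mathbf{0} \text{ and } \mathrm{Sig}(\alpha,c)(x)\ge 0 \text{ for all } x \in X\}.$$ The relative entropy function $D$ is the convex function with domain $\mathbb{R}^{\ell}_+\times\mathbb{R}^{\ell}_+$ given by $D(u,v)=\sum_{j=1}^{\ell} u_j\log(u_j/v_j)$, with the usual conventions: a term with $u_j=0$ is $0$, and a term with $u_j>0$, $v_j=0$ is $+\infty$. A vector $\nu$ satisfying the inequality must lie in the domain of $D$, i.e. $\nu\ge\mathbf{0}$ (equivalently, $D=+\infty$ outside its domain), and $D(\nu,c_{\setminus i})$ must be finite. The support function takes values in $[-\infty,+\infty]$;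 for $X=\emptyset$ one has $\sigma_X\equiv-\infty$, and the inequality then reads $-\infty\le c_i$, which is true. *)

theory Defs
  imports "HOL-Analysis.Analysis"
begin

text \<open>
  Vectors in \<open>\<real>\<^sup>m\<close> are elements of \<open>real ^ 'm\<close>. Deleting the entry \<open>i\<close> leaves a vector whose
  \<open>m - 1\<close> entries keep their original labels: it is an extensional function on the finite index
  set \<open>- {i}\<close> (which is empty when \<open>m = 1\<close>), so that \<open>- {i} \<rightarrow>\<^sub>E UNIV\<close> plays the role of
  \<open>\<real>\<^bsup>m-1\<^esup>\<close>. Applied to a matrix \<open>real ^ 'n ^ 'm\<close>, the same operation deletes the row \<open>i\<close>.
\<close>

definition delete_entry :: "'m \<Rightarrow> 'a ^ 'm \<Rightarrow> 'm \<Rightarrow> 'a" where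
  "delete_entry i v = restrict (\<lambda>j. v $ j) (- {i})"

definition sig :: "real ^ 'n ^ 'm \<Rightarrow> real ^ 'm \<Rightarrow> real ^ 'n \<Rightarrow> real" where
  "sig \<alpha> c x = (\<Sum>j\<in>UNIV. c $ j * exp (\<alpha> $ j \<bullet> x))"

definition age_cone :: "real ^ 'n ^ 'm \<Rightarrow> 'm \<Rightarrow> (real ^ 'n) set \<Rightarrow> (real ^ 'm) set" where
  "age_cone \<alpha> k X =
     {c. (\<forall>j\<in>- {k}. 0 \<le> delete_entry k c j) \<and> (\<forall>x\<in>X. 0 \<le> sig \<alpha> c x)}"

definition support_fun :: "(real ^ 'n) set \<Rightarrow> real ^ 'n \<Rightarrow> ereal" where
  "support_fun X lam = (SUP x\<in>X. ereal (lam \<bullet> x))"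

definition rel_entropy_term :: "real \<Rightarrow> real \<Rightarrow> ereal" where
  "rel_entropy_term u v =
     (if u = 0 then 0 else if v = 0 then \<infinity> else ereal (u * ln (u / v)))"

definition rel_entropy :: "'j set \<Rightarrow> ('j \<Rightarrow> real) \<Rightarrow> ('j \<Rightarrow> real) \<Rightarrow> ereal" where
  "rel_entropy J u v =
     (if \<forall>j\<in>J. 0 \<le> u j \<and> 0 \<le> v j then \<Sum>j\<in>J. rel_entropy_term (u j) (v j) else \<infinity>)"

end

theory Submission imports Defs
begin

text \<open>
  Dividing by \<open>exp (\<alpha>\<^sub>i \<bullet> x)\<close> turns nonnegativity of the signomial into the bound
  \<open>- c\<^sub>i \<le> g (A x)\<close> for \<open>x \<in> X\<close>, where \<open>A\<close> has rows \<open>\<alpha>\<^sub>j - \<alpha>\<^sub>i\<close> and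
  \<open>g y = (\<Sum>j. c\<^sub>j exp y\<^sub>j)\<close> is convex and finite everywhere. Since \<open>g\<close> is finite everywhere, the
  hyperplane that separates the epigraph of \<open>g\<close> from the points of \<open>A X\<close> at heights below \<open>- c\<^sub>i\<close>
  cannot be vertical. Its slope is \<open>- \<nu>\<close>, and the relative entropy appears as the convex conjugate
  of \<open>g\<close>. The converse direction is the Fenchel-Young inequality.
\<close>

section \<open>Conjugate of a sum of exponentials\<close>

lemma exp_fenchel_young:
  fixes u v t :: real
  assumes "0 \<le> u" "0 \<le> v" "v = 0 \<longrightarrow> u = 0"
  shows "u * t \<le> v * exp t + (u * ln (u / v) - u)"
proof (cases "u = 0")
  case True
  then show ?thesis using assms by simp
next
  case False
  with assms have u: "0 < u" and v: "0 < v" by auto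
  \<comment> \<open>The tangent to \<open>v * exp\<close> at \<open>ln (u / v)\<close>, the point
    where its slope is \<open>u\<close>.\<close>
  have "1 + (t - ln (u / v)) \<le> exp (t - ln (u / v))"
    by (rule exp_ge_add_one_self)
  also have "\<dots> = exp t * v / u"
    using u v by (simp add: exp_diff)
  finally have "u * (1 + (t - ln (u / v))) \<le> u * (exp t * v / u)"
    using u by (intro mult_left_mono) auto
  then show ?thesis using u by (simp add: algebra_simps)
qed

text \<open>Each conclusion tests \<open>bound\<close> at a chosen \<open>y\<close>: one extreme
  coordinate gives the sign and support of \<open>u\<close>, and near-maximizers give the entropy
  bound.\<close>

lemma exp_sum_conjugate_le:
  fixes u v :: "'m::finite \<Rightarrow> real"
  assumes v: "\<And>j. 0 \<le> v j"
    and bound: "\<And>y. (\<Sum>j\<in>UNIV. u j * y j) - (\<Sum>j\<in>UNIV. v j * exp (y j)) \<le> b"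
  shows "0 \<le> u j" and "v j = 0 \<Longrightarrow> u j = 0"
    and "(\<Sum>j\<in>UNIV. u j * ln (u j / v j) - u j) \<le> b"
proof -
  define V where "V = (\<Sum>j\<in>UNIV. v j)"
  have V: "0 \<le> V" unfolding V_def by (simp add: sum_nonneg v)
  have dom: "0 \<le> u k \<and> (v k = 0 \<longrightarrow> u k = 0)" for k
  proof (rule ccontr)
    assume "\<not> ?thesis"
    then have k: "u k < 0 \<or> v k = 0 \<and> u k \<noteq> 0" by auto
    \<comment> \<open>The linear part becomes \<open>\<bar>b\<bar> + V + 1\<close>. The exponential
      sum stays at most \<open>V\<close>, since either \<open>t \<le> 0\<close> or the coefficient
      \<open>v k\<close> vanishes.\<close>
    define t where "t = (\<bar>b\<bar> + V + 1) / u k"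
    let ?y = "\<lambda>j. if j = k then t else 0"
    have "v j * exp (?y j) \<le> v j" for j
    proof -
      have "t \<le> 0" if "u k < 0"
        using that V by (simp add: t_def divide_nonneg_neg)
      then show ?thesis using k v[of j] by (auto simp: mult_left_le)
    qed
    then have "(\<Sum>j\<in>UNIV. v j * exp (?y j)) \<le> V"
      unfolding V_def by (rule sum_mono)
    moreover have "(\<Sum>j\<in>UNIV. u j * ?y j) = u k * t"
      by (simp add: if_distrib[of "(*) _"] cong: if_cong)
    moreover have "u k * t = \<bar>b\<bar> + V + 1"
      using k by (auto simp: t_def)
    ultimately show False using bound[of ?y] by linarith
  qed
  then show "0 \<le> u j" and "v j = 0 \<Longrightarrow> u j = 0" by auto
  let ?S = "\<Sum>j\<in>UNIV. u j * ln (u j / v j) - u j"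
  have approx: "?S \<le> b + e * V" if e: "0 < e" for e
  proof -
    \<comment> \<open>For \<open>u j > 0\<close> this is the exact maximizer. For
      \<open>u j = 0\<close> the supremum 0 may only be approached as the coordinate tends to minus
      infinity; stopping at \<open>ln e\<close> costs \<open>e * v j\<close>.\<close>
    define y where "y j = (if u j = 0 then ln e else ln (u j / v j))" for j
    have "u j * ln (u j / v j) - u j - e * v j \<le> u j * y j - v j * exp (y j)" for j
    proof (cases "u j = 0")
      case True
      then show ?thesis using e by (simp add: y_def)
    next
      case False
      then have "0 < u j" "0 < v j"
        using dom[of j] v[of j] by (auto simp: less_le)
      then show ?thesis using e by (simp add: y_def)
    qed
    then have "(\<Sum>j\<in>UNIV. u j * ln (u j / v j) - u j - e * v j)
        \<le> (\<Sum>j\<in>UNIV. u j * y j - v j * exp (y j))"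
      by (rule sum_mono)
    then show ?thesis
      using bound[of y] by (simp add: sum_subtractf V_def flip: sum_distrib_left)
  qed
  show "?S \<le> b"
  proof (rule field_le_epsilon)
    fix d :: real
    assume d: "0 < d"
    \<comment> \<open>\<open>V + 1\<close> in place of \<open>V\<close>, since \<open>V\<close> may
      be 0.\<close>
    have "?S \<le> b + d / (V + 1) * V" using d V by (intro approx) simp
    also have "d / (V + 1) * V \<le> d" using d V by (simp add: field_simps)
    finally show "?S \<le> b + d" by simp
  qed
qed

section \<open>Separation and the real-valued duality\<close>

lemma convex_on_exp_sum:
  fixes v :: "'m::finite \<Rightarrow> real"
  assumes "\<And>j. 0 \<le> v j"
  shows "convex_on UNIV (\<lambda>y::real ^ 'm. \<Sum>j\<in>UNIV. v j * exp (y $ j))"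
proof (rule convex_onI)
  fix t :: real and x y :: "real ^ 'm"
  assume t: "0 < t" "t < 1"
  have "v j * exp (((1 - t) *\<^sub>R x + t *\<^sub>R y) $ j)
      \<le> (1 - t) * (v j * exp (x $ j)) + t * (v j * exp (y $ j))" for j
  proof -
    have "exp ((1 - t) *\<^sub>R x $ j + t *\<^sub>R y $ j) \<le> (1 - t) * exp (x $ j) + t * exp (y $ j)"
      using t by (intro convex_onD[OF exp_convex]) auto
    from mult_left_mono[OF this assms] show ?thesis by (simp add: algebra_simps)
  qed
  then show "(\<Sum>j\<in>UNIV. v j * exp (((1 - t) *\<^sub>R x + t *\<^sub>R y) $ j))
      \<le> (1 - t) * (\<Sum>j\<in>UNIV. v j * exp (x $ j)) + t * (\<Sum>j\<in>UNIV. v j * exp (y $ j))"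
    unfolding sum_distrib_left sum.distrib[symmetric] by (rule sum_mono)
qed simp

text \<open>One hyperplane separates all of \<open>Y\<close> at heights below \<open>b\<close> from
  the epigraph, so a single slope \<open>w\<close> serves every \<open>y\<close> in
  \<open>Y\<close>. This uniformity is what later permits a supremum over \<open>X\<close>.\<close>

lemma finite_convex_affine_minorant:
  fixes g :: "'a::euclidean_space \<Rightarrow> real"
  assumes g: "convex_on UNIV g" and Y: "convex Y" "Y \<noteq> {}" and b: "\<And>y. y \<in> Y \<Longrightarrow> b \<le> g y"
  obtains w where "\<And>y z. y \<in> Y \<Longrightarrow> b + w \<bullet> (z - y) \<le> g z"
proof -
  let ?E = "epigraph UNIV g" and ?H = "Y \<times> {..<b}"
  have "convex ?E" using g by (rule convex_epigraphI)
  moreover have "convex ?H" using Y by (intro convex_Times) auto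
  moreover have "?H \<noteq> {}" using Y(2) lt_ex[of b] by auto
  moreover have "(0, g 0) \<in> ?E" by (simp add: mem_epigraph)
  moreover have "?H \<inter> ?E = {}" using b by (force simp: mem_epigraph)
  ultimately obtain p d where p: "p \<noteq> 0"
      and H: "\<And>q. q \<in> ?H \<Longrightarrow> p \<bullet> q \<le> d" and E: "\<And>q. q \<in> ?E \<Longrightarrow> d \<le> p \<bullet> q"
    using separating_hyperplane_sets[of ?H ?E] by blast
  obtain a r where p_eq: "p = (a, r)" by (cases p)
  have sep: "a \<bullet> y + r * s \<le> a \<bullet> z + r * t" if "y \<in> Y" "s < b" "g z \<le> t" for y s z t
    using order_trans[OF H[of "(y, s)"] E[of "(z, t)"]] that
    by (simp add: p_eq mem_epigraph)
  obtain y0 where y0: "y0 \<in> Y" using Y(2) by blast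
  have "0 < r"
  proof -
    have "0 \<le> r"
      \<comment> \<open>With equal base points \<open>a\<close> cancels, and comparing heights alone
        excludes a negative \<open>r\<close>.\<close>
      using sep[of y0 "b - 1" y0 "max (g y0) b"] y0
      by (smt (verit) max.cobounded1 max.cobounded2 mult_strict_left_mono_neg)
    moreover have "r \<noteq> 0"
    proof
      assume r: "r = 0"
      \<comment> \<open>The epigraph lies over the whole space, so the comparison point may be moved
        from \<open>y0\<close> against \<open>a\<close>; a vertical hyperplane would then have
        \<open>a = 0\<close>.\<close>
      then have "a \<bullet> y0 \<le> a \<bullet> (y0 - a)"
        using sep[of y0 "b - 1" "y0 - a" "g (y0 - a)"] y0 by simp
      then have "a \<bullet> a \<le> 0" by (simp add: inner_diff_right)
      then have "a = 0" by (metis inner_gt_zero_iff not_less)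
      then show False using p r by (simp add: p_eq zero_prod_def)
    qed
    ultimately show ?thesis by simp
  qed
  show thesis
  proof
    fix y z
    assume y: "y \<in> Y"
    \<comment> \<open>After division by \<open>r\<close>, letting \<open>s\<close> rise to
      \<open>b\<close> recovers the bound at height \<open>b\<close> itself.\<close>
    have "s \<le> g z + a \<bullet> (z - y) / r" if "s < b" for s
      using sep[OF y that, of z "g z"] \<open>0 < r\<close> by (simp add: field_simps inner_diff_right)
    then have "b \<le> g z + a \<bullet> (z - y) / r" by (rule dense_le)
    then show "b + (- (a /\<^sub>R r)) \<bullet> (z - y) \<le> g z" by (simp add: field_simps)
  qed
qed

text \<open>The inner condition says that the support function at minus the
  \<open>u\<close>-weighted sum of the \<open>a j\<close>, plus the entropy, minus the sum of
  \<open>u\<close>, is at most \<open>- b\<close>. Spelling the supremum out at each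
  \<open>x\<close> keeps everything real.\<close>

lemma exp_sum_lower_bound_iff:
  fixes a :: "'m::finite \<Rightarrow> 'a::euclidean_space" and v :: "'m \<Rightarrow> real"
  assumes X: "convex X" and v: "\<And>j. 0 \<le> v j"
  shows "(\<forall>x\<in>X. b \<le> (\<Sum>j\<in>UNIV. v j * exp (a j \<bullet> x))) \<longleftrightarrow>
    (\<exists>u. (\<forall>j. 0 \<le> u j \<and> (v j = 0 \<longrightarrow> u j = 0)) \<and>
      (\<forall>x\<in>X. (\<Sum>j\<in>UNIV. u j * ln (u j / v j) - u j) - (\<Sum>j\<in>UNIV. u j * (a j \<bullet> x)) \<le> - b))"
    (is "?primal \<longleftrightarrow> ?dual")
proof
  assume ?dual
  then obtain u where u: "\<And>j. 0 \<le> u j" "\<And>j. v j = 0 \<longrightarrow> u j = 0"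
    and le: "\<And>x. x \<in> X \<Longrightarrow>
      (\<Sum>j\<in>UNIV. u j * ln (u j / v j) - u j) - (\<Sum>j\<in>UNIV. u j * (a j \<bullet> x)) \<le> - b"
    by blast
  show ?primal
  proof
    fix x
    assume x: "x \<in> X"
    have "(\<Sum>j\<in>UNIV. u j * (a j \<bullet> x))
        \<le> (\<Sum>j\<in>UNIV. v j * exp (a j \<bullet> x) + (u j * ln (u j / v j) - u j))"
      by (intro sum_mono exp_fenchel_young u v)
    then show "b \<le> (\<Sum>j\<in>UNIV. v j * exp (a j \<bullet> x))"
      using le[OF x] by (simp add: sum.distrib)
  qed
next
  assume primal: ?primal
  show ?dual
  proof (cases "X = {}")
    case True
    then show ?thesis by (intro exI[of _ "\<lambda>_. 0"]) simp
  next
    case False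
    define A where "A x = (\<chi> j. a j \<bullet> x)" for x
    have "linear A"
      by (rule linearI) (simp_all add: A_def vec_eq_iff inner_add_right)
    then have "convex (A ` X)" using X by (rule convex_linear_image)
    moreover have "A ` X \<noteq> {}" using False by simp
    moreover have "b \<le> (\<Sum>j\<in>UNIV. v j * exp (y $ j))" if "y \<in> A ` X" for y
      using that primal by (auto simp: A_def)
    ultimately obtain w where w: "\<And>y z. y \<in> A ` X \<Longrightarrow>
        b + w \<bullet> (z - y) \<le> (\<Sum>j\<in>UNIV. v j * exp (z $ j))"
      by (rule finite_convex_affine_minorant[OF convex_on_exp_sum[OF v]]) auto
    let ?u = "\<lambda>j. w $ j"
    \<comment> \<open>Here \<open>y\<close> is free, so the right-hand side bounds the conjugate for
      each \<open>x\<close>. One point \<open>x0\<close> settles sign and support; the entropy bound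
      is drawn from every \<open>x\<close>.\<close>
    have bound: "(\<Sum>j\<in>UNIV. ?u j * y j) - (\<Sum>j\<in>UNIV. v j * exp (y j))
        \<le> (\<Sum>j\<in>UNIV. ?u j * (a j \<bullet> x)) - b" if "x \<in> X" for x y
      using w[of "A x" "\<chi> j. y j"] that
      by (simp add: inner_diff_right) (simp add: inner_vec_def A_def)
    obtain x0 where x0: "x0 \<in> X" using False by blast
    show ?thesis
    proof (intro exI[of _ ?u] conjI allI ballI)
      show "0 \<le> ?u j" for j
        by (rule exp_sum_conjugate_le(1)[OF v bound[OF x0]])
      show "v j = 0 \<longrightarrow> ?u j = 0" for j
        using exp_sum_conjugate_le(2)[OF v bound[OF x0]] by blast
      show "(\<Sum>j\<in>UNIV. ?u j * ln (?u j / v j) - ?u j) - (\<Sum>j\<in>UNIV. ?u j * (a j \<bullet> x)) \<le> - b"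
        if "x \<in> X" for x
        using exp_sum_conjugate_le(3)[OF v bound[OF that]] by linarith
    qed
  qed
qed

section \<open>Reduction of the extended-real expressions to real ones\<close>

lemma rel_entropy_finite_iff:
  assumes "finite J"
  shows "rel_entropy J u v < \<infinity> \<longleftrightarrow> (\<forall>j\<in>J. 0 \<le> u j \<and> 0 \<le> v j \<and> (v j = 0 \<longrightarrow> u j = 0))"
  using assms by (auto simp: rel_entropy_def less_top[symmetric] top_ereal_def sum_Pinfty
      rel_entropy_term_def)

lemma rel_entropy_eq_ereal:
  assumes "\<forall>j\<in>J. 0 \<le> u j \<and> 0 \<le> v j \<and> (v j = 0 \<longrightarrow> u j = 0)"
  shows "rel_entropy J u v = ereal (\<Sum>j\<in>J. u j * ln (u j / v j))"
proof -
  have "(\<Sum>j\<in>J. rel_entropy_term (u j) (v j)) = (\<Sum>j\<in>J. ereal (u j * ln (u j / v j)))"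
    \<comment> \<open>Where \<open>u j = 0\<close>, the real product \<open>0 * ln (0 / v j)\<close>
      is 0, in agreement with the entropy convention.\<close>
    using assms by (intro sum.cong) (auto simp: rel_entropy_term_def zero_ereal_def)
  then show ?thesis using assms by (simp add: rel_entropy_def)
qed

text \<open>\<open>d\<close> and \<open>s\<close> are real, so they can be moved across even when
  the support function is infinite; an empty \<open>X\<close> makes both sides true.\<close>

lemma support_fun_bound_iff:
  "support_fun X l + ereal d - ereal s \<le> ereal e \<longleftrightarrow> (\<forall>x\<in>X. l \<bullet> x + d - s \<le> e)"
proof -
  have "support_fun X l + ereal d - ereal s \<le> ereal e \<longleftrightarrow> support_fun X l \<le> ereal (e - d + s)"
    by (cases "support_fun X l") auto
  also have "\<dots> \<longleftrightarrow> (\<forall>x\<in>X. l \<bullet> x + d - s \<le> e)"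
    by (auto simp: support_fun_def SUP_le_iff algebra_simps)
  finally show ?thesis .
qed

lemma sig_nonneg_iff:
  "0 \<le> sig \<alpha> c x \<longleftrightarrow> - (c $ i) \<le> (\<Sum>j\<in>- {i}. c $ j * exp ((\<alpha> $ j - \<alpha> $ i) \<bullet> x))"
proof -
  have "sig \<alpha> c x = c $ i * exp (\<alpha> $ i \<bullet> x) + (\<Sum>j\<in>- {i}. c $ j * exp (\<alpha> $ j \<bullet> x))"
    unfolding sig_def by (subst sum.remove[of _ i]) (auto simp: Compl_eq_Diff_UNIV)
  also have "\<dots> = exp (\<alpha> $ i \<bullet> x) *
      (c $ i + (\<Sum>j\<in>- {i}. c $ j * exp ((\<alpha> $ j - \<alpha> $ i) \<bullet> x)))"
    by (simp add: distrib_left sum_distrib_left inner_diff_left exp_diff mult.commute)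
  finally show ?thesis by (simp add: zero_le_mult_iff not_le[symmetric]) linarith
qed

section \<open>Transfer of the duality to the AGE cone\<close>

theorem theorem6:
  fixes \<alpha> :: "real ^ 'n ^ 'm" and i :: 'm and X :: "(real ^ 'n) set"
  assumes "convex X"
  shows "age_cone \<alpha> i X =
    {c. \<exists>\<nu> \<in> - {i} \<rightarrow>\<^sub>E (UNIV :: real set). \<exists>lam :: real ^ 'n.
          rel_entropy (- {i}) \<nu> (delete_entry i c) < \<infinity> \<and>
          support_fun X lam + rel_entropy (- {i}) \<nu> (delete_entry i c)
            - ereal (\<Sum>j\<in>- {i}. \<nu> j) \<le> ereal (c $ i) \<and>
          (\<Sum>j\<in>- {i}. \<nu> j *\<^sub>R (delete_entry i \<alpha> j - \<alpha> $ i)) + lam = 0 \<and>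
          (\<forall>j\<in>- {i}. 0 \<le> delete_entry i c j)}"
proof (rule set_eqI)
  fix c :: "real ^ 'm"
  let ?J = "- {i}" and ?a = "\<lambda>j. \<alpha> $ j - \<alpha> $ i"
  \<comment> \<open>Padding with 0 lets the duality sum over the whole index type; its condition
    \<open>v i = 0 \<longrightarrow> u i = 0\<close> then removes coordinate \<open>i\<close> from
    \<open>u\<close>.\<close>
  define v where "v j = (if j = i then 0 else c $ j)" for j
  let ?nonneg = "\<forall>j\<in>?J. 0 \<le> delete_entry i c j"
  let ?P = "\<lambda>\<nu> lam. rel_entropy ?J \<nu> (delete_entry i c) < \<infinity> \<and>
    support_fun X lam + rel_entropy ?J \<nu> (delete_entry i c) - ereal (\<Sum>j\<in>?J. \<nu> j) \<le> ereal (c $ i) \<and>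
    (\<Sum>j\<in>?J. \<nu> j *\<^sub>R (delete_entry i \<alpha> j - \<alpha> $ i)) + lam = 0 \<and> ?nonneg"
  \<comment> \<open>The dual side of \<open>exp_sum_lower_bound_iff\<close> at
    \<open>b = - (c $ i)\<close>; the double negation is kept to match its form.\<close>
  let ?Q = "\<lambda>u. (\<forall>j. 0 \<le> u j \<and> (v j = 0 \<longrightarrow> u j = 0)) \<and>
    (\<forall>x\<in>X. (\<Sum>j\<in>UNIV. u j * ln (u j / v j) - u j) - (\<Sum>j\<in>UNIV. u j * (?a j \<bullet> x)) \<le> - (- (c $ i)))"
  have drop_i: "(\<Sum>j\<in>UNIV. f j) = (\<Sum>j\<in>?J. f j)" if "f i = 0" for f :: "'m \<Rightarrow> real"
    using that by (intro sum.mono_neutral_right) auto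
  \<comment> \<open>The linear equation determines \<open>lam\<close> from \<open>\<nu>\<close>. The
    update at \<open>i\<close> replaces the irrelevant value there, \<open>undefined\<close> for
    extensional \<open>\<nu>\<close>, by the padding value.\<close>
  have P_iff: "?P \<nu> lam \<longleftrightarrow> ?Q (\<nu>(i := 0)) \<and> lam = - (\<Sum>j\<in>?J. \<nu> j *\<^sub>R ?a j)"
    if nn: ?nonneg for \<nu> :: "'m \<Rightarrow> real" and lam
  proof -
    let ?u = "\<nu>(i := 0)"
    have dom: "rel_entropy ?J \<nu> (delete_entry i c) < \<infinity> \<longleftrightarrow> (\<forall>j. 0 \<le> ?u j \<and> (v j = 0 \<longrightarrow> ?u j = 0))"
      unfolding rel_entropy_finite_iff[OF finite] using nn by (auto simp: delete_entry_def v_def)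
    have ent: "rel_entropy ?J \<nu> (delete_entry i c) = ereal (\<Sum>j\<in>?J. \<nu> j * ln (\<nu> j / c $ j))"
      if "rel_entropy ?J \<nu> (delete_entry i c) < \<infinity>"
    proof -
      have "\<forall>j\<in>?J. 0 \<le> \<nu> j \<and> 0 \<le> delete_entry i c j \<and> (delete_entry i c j = 0 \<longrightarrow> \<nu> j = 0)"
        using that unfolding rel_entropy_finite_iff[OF finite] .
      then have "rel_entropy ?J \<nu> (delete_entry i c)
          = ereal (\<Sum>j\<in>?J. \<nu> j * ln (\<nu> j / delete_entry i c j))"
        by (rule rel_entropy_eq_ereal)
      also have "(\<Sum>j\<in>?J. \<nu> j * ln (\<nu> j / delete_entry i c j)) = (\<Sum>j\<in>?J. \<nu> j * ln (\<nu> j / c $ j))"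
        by (intro sum.cong) (auto simp: delete_entry_def)
      finally show ?thesis .
    qed
    have lam: "(\<Sum>j\<in>?J. \<nu> j *\<^sub>R (delete_entry i \<alpha> j - \<alpha> $ i)) + lam = 0
        \<longleftrightarrow> lam = - (\<Sum>j\<in>?J. \<nu> j *\<^sub>R ?a j)"
    proof -
      have "(\<Sum>j\<in>?J. \<nu> j *\<^sub>R (delete_entry i \<alpha> j - \<alpha> $ i)) = (\<Sum>j\<in>?J. \<nu> j *\<^sub>R ?a j)"
        by (intro sum.cong) (auto simp: delete_entry_def)
      then show ?thesis by (simp add: add_eq_0_iff)
    qed
    have S1: "(\<Sum>j\<in>UNIV. ?u j * ln (?u j / v j) - ?u j)
        = (\<Sum>j\<in>?J. \<nu> j * ln (\<nu> j / c $ j)) - (\<Sum>j\<in>?J. \<nu> j)"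
    proof -
      have "(\<Sum>j\<in>UNIV. ?u j * ln (?u j / v j) - ?u j) = (\<Sum>j\<in>?J. ?u j * ln (?u j / v j) - ?u j)"
        by (rule drop_i) simp
      also have "\<dots> = (\<Sum>j\<in>?J. \<nu> j * ln (\<nu> j / c $ j) - \<nu> j)"
        by (intro sum.cong) (auto simp: v_def)
      finally show ?thesis by (simp add: sum_subtractf)
    qed
    have S2: "(\<Sum>j\<in>UNIV. ?u j * (?a j \<bullet> x)) = (\<Sum>j\<in>?J. \<nu> j *\<^sub>R ?a j) \<bullet> x" for x
    proof -
      have "(\<Sum>j\<in>UNIV. ?u j * (?a j \<bullet> x)) = (\<Sum>j\<in>?J. ?u j * (?a j \<bullet> x))"
        by (rule drop_i) simp
      also have "\<dots> = (\<Sum>j\<in>?J. \<nu> j * (?a j \<bullet> x))"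
        by (intro sum.cong) auto
      finally show ?thesis by (simp add: inner_sum_left)
    qed
    have bnd: "support_fun X (- w) + ereal d - ereal s \<le> ereal (c $ i)
        \<longleftrightarrow> (\<forall>x\<in>X. d - s - w \<bullet> x \<le> - (- (c $ i)))" for w d s
      unfolding support_fun_bound_iff by (simp add: algebra_simps)
    show ?thesis
    \<comment> \<open>The real formula for the entropy is available only when it is finite;
      otherwise both sides fail by \<open>dom\<close>.\<close>
    proof (cases "rel_entropy ?J \<nu> (delete_entry i c) < \<infinity>")
      case True
      show ?thesis
        unfolding lam S1 S2 dom[symmetric] bnd[symmetric] ent[OF True, symmetric]
        using nn by blast
    next
      case False
      then show ?thesis unfolding dom[symmetric] by blast
    qed
  qed
  have "c \<in> age_cone \<alpha> i X \<longleftrightarrow> ?nonneg \<and> (\<exists>u. ?Q u)"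
  proof -
    have "(\<forall>x\<in>X. 0 \<le> sig \<alpha> c x) \<longleftrightarrow> (\<exists>u. ?Q u)" if ?nonneg
    proof -
      have "0 \<le> v j" for j using that by (simp add: v_def delete_entry_def)
      note exp_sum_lower_bound_iff[where v = v and b = "- (c $ i)" and a = ?a, OF assms this]
      moreover have "(\<Sum>j\<in>UNIV. v j * exp (?a j \<bullet> x)) = (\<Sum>j\<in>?J. c $ j * exp (?a j \<bullet> x))" for x
      proof -
        have "(\<Sum>j\<in>UNIV. v j * exp (?a j \<bullet> x)) = (\<Sum>j\<in>?J. v j * exp (?a j \<bullet> x))"
          by (rule drop_i) (simp add: v_def)
        also have "\<dots> = (\<Sum>j\<in>?J. c $ j * exp (?a j \<bullet> x))"
          by (intro sum.cong) (auto simp: v_def)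
        finally show ?thesis .
      qed
      ultimately show ?thesis by (simp only: sig_nonneg_iff[of _ _ _ i])
    qed
    then show ?thesis by (auto simp: age_cone_def)
  qed
  also have "\<dots> \<longleftrightarrow> (\<exists>\<nu> \<in> ?J \<rightarrow>\<^sub>E (UNIV :: real set). \<exists>lam. ?P \<nu> lam)"
  proof (cases ?nonneg)
    case True
    \<comment> \<open>Since \<open>u i = 0\<close>, restricting \<open>u\<close> to
      \<open>?J\<close> and resetting \<open>i\<close> to 0 loses nothing.\<close>
    have "\<exists>\<nu> \<in> ?J \<rightarrow>\<^sub>E UNIV. ?Q (\<nu>(i := 0))" if "?Q u" for u
    proof
      have "u i = 0" using that by (simp add: v_def)
      then have "(restrict u ?J)(i := 0) = u" by auto
      with that show "?Q ((restrict u ?J)(i := 0))" by simp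
    qed auto
    then have "(\<exists>u. ?Q u) \<longleftrightarrow> (\<exists>\<nu> \<in> ?J \<rightarrow>\<^sub>E UNIV. ?Q (\<nu>(i := 0)))" by blast
    then show ?thesis unfolding P_iff[OF True] using True by blast
  next
    case False
    then show ?thesis by blast
  qed
  finally show "c \<in> age_cone \<alpha> i X \<longleftrightarrow>
      c \<in> {c. \<exists>\<nu> \<in> - {i} \<rightarrow>\<^sub>E (UNIV :: real set). \<exists>lam :: real ^ 'n.
          rel_entropy (- {i}) \<nu> (delete_entry i c) < \<infinity> \<and>
          support_fun X lam + rel_entropy (- {i}) \<nu> (delete_entry i c)
            - ereal (\<Sum>j\<in>- {i}. \<nu> j) \<le> ereal (c $ i) \<and>
          (\<Sum>j\<in>- {i}. \<nu> j *\<^sub>R (delete_entry i \<alpha> j - \<alpha> $ i)) + lam = 0 \<and>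
          (\<forall>j\<in>- {i}. 0 \<le> delete_entry i c j)}"
    by (simp only: mem_Collect_eq)
qed

end
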